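(* There exist infinitely many graphs $G$ for which $\operatorname{th}_c^{\times}(G)$ is not achieved by any set of size $\gamma(G)$ nor by any set of size $c(G)$, i.e., $\operatorname{th}_c^{\times}(G,\gamma(G))>\operatorname{th}_c^{\times}(G)$ and $\operatorname{th}_c^{\times}(G,c(G))>\operatorname{th}_c^{\times}(G)$. In particular, this is the case for $G=M(\ell)$ for every $\ell\ge 7$.
   Context: For a positive integer $\ell$, $M'(\ell)$ is obtained from the disjoint union of a $4$-cycle $C_4$ and three copies of the path $P_\ell$ by pairing the three paths with three distinct vertices of $C_4$ and adding an edge from an endpoint of each path to its paired vertex of $C_4$; $M(\ell)$ is obtained from $M'(\ell)$ by attaching a new leaf to every vertex of $M'(\ell)$ (so $M(\ell)$ has $6\ell+8$ vertices). $\gamma(G)$ is the domination number and $c(G)$ the cop number. In the game of Cops and Robbers, the cops first occupy a multiset $S$ of vertices, then the robber chooses a vertex; in each round every cop moves to an adjacent vertex or stays, then the robber does likewise; perfect information; capture occurs when a cop occupies the robber's vertex; $c(G)$ is the minimum number of cops guaranteeing capture. $\operatorname{capt}(G;S)$ is the optimal-play number of rounds to capture with cops starting on $S$ ($\infty$ if not guaranteed). $\operatorname{th}_c^{\times}(G;S)=|S|(1+\operatorname{capt}(G;S))$, $\operatorname{th}_c^{\times}(G,k)=\min_{|S|=k}\operatorname{th}_c^{\times}(G;S)$, and $\operatorname{th}_c^{\times}(G)=\min_k\operatorname{th}_c^{\times}(G,k)$. *)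

theory Defs
  imports
    "Graph_Theory.Pair_Digraph"
    "Graph_Theory.Digraph_Isomorphism"
    "HOL-Library.Multiset"
    "HOL-Library.Extended_Nat"
begin

text \<open>
  Finite simple graphs are represented by the locale predicate \<^const>\<open>pair_graph\<close>: finite vertex set,
  finite symmetric irreflexive arc relation.
\<close>

definition dominating_set :: "'a pair_pre_digraph \<Rightarrow> 'a set \<Rightarrow> bool" where
  "dominating_set G D \<longleftrightarrow>
     D \<subseteq> pverts G \<and> (\<forall>v\<in>pverts G. v \<in> D \<or> (\<exists>u\<in>D. (u, v) \<in> parcs G))"

definition domination_number :: "'a pair_pre_digraph \<Rightarrow> nat" where
  "domination_number G = (LEAST k. \<exists>D. dominating_set G D \<and> card D = k)"

definition step :: "'a pair_pre_digraph \<Rightarrow> 'a \<Rightarrow> 'a \<Rightarrow> bool" where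
  "step G u v \<longleftrightarrow> u = v \<or> (u, v) \<in> parcs G"

definition placements :: "'a pair_pre_digraph \<Rightarrow> nat \<Rightarrow> 'a multiset set" where
  "placements G k = {S. set_mset S \<subseteq> pverts G \<and> size S = k}"

text \<open>
  \<^term>\<open>R n\<close> is the robber's position at the end of round \<^term>\<open>n\<close>, the initial choice being \<^term>\<open>R 0\<close>.
\<close>

definition robber_walk :: "'a pair_pre_digraph \<Rightarrow> (nat \<Rightarrow> 'a) \<Rightarrow> bool" where
  "robber_walk G R \<longleftrightarrow> R 0 \<in> pverts G \<and> (\<forall>n. step G (R n) (R (Suc n)))"

text \<open>
  A cop strategy maps the list of robber positions seen so far to the multiset of cop positions.
  In round \<^term>\<open>Suc n\<close> the cops move knowing \<^term>\<open>R 0\<close>, \dots, \<^term>\<open>R n\<close>; the initial placement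
  (the value at the empty list) is made before the robber's choice. Play formally
  continues after capture, which affects neither side as only the first capture counts.
\<close>

definition cops_at :: "('a list \<Rightarrow> 'a multiset) \<Rightarrow> (nat \<Rightarrow> 'a) \<Rightarrow> nat \<Rightarrow> 'a multiset" where
  "cops_at \<sigma> R n = \<sigma> (map R [0..<n])"

definition cop_strategy ::
  "'a pair_pre_digraph \<Rightarrow> 'a multiset \<Rightarrow> ('a list \<Rightarrow> 'a multiset) \<Rightarrow> bool" where
  "cop_strategy G S \<sigma> \<longleftrightarrow>
     \<sigma> [] = S \<and>
     (\<forall>R. robber_walk G R \<longrightarrow>
        (\<forall>n. rel_mset (step G) (cops_at \<sigma> R n) (cops_at \<sigma> R (Suc n))))"

text \<open>
  Capture in round \<^term>\<open>Suc m\<close> happens if a cop moves onto the robber's current vertex \<^term>\<open>R m\<close>,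
  or if the robber then ends the round on a vertex occupied by a cop.
\<close>

definition captured_in_round ::
  "('a list \<Rightarrow> 'a multiset) \<Rightarrow> (nat \<Rightarrow> 'a) \<Rightarrow> nat \<Rightarrow> bool" where
  "captured_in_round \<sigma> R n \<longleftrightarrow>
     R n \<in># cops_at \<sigma> R n \<or> (\<exists>m. n = Suc m \<and> R m \<in># cops_at \<sigma> R n)"

definition capture_round :: "('a list \<Rightarrow> 'a multiset) \<Rightarrow> (nat \<Rightarrow> 'a) \<Rightarrow> enat" where
  "capture_round \<sigma> R = (INF n\<in>{n. captured_in_round \<sigma> R n}. enat n)"

definition capt :: "'a pair_pre_digraph \<Rightarrow> 'a multiset \<Rightarrow> enat" where
  "capt G S = (INF \<sigma>\<in>{\<sigma>. cop_strategy G S \<sigma>}. SUP R\<in>{R. robber_walk G R}. capture_round \<sigma> R)"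

definition cops_win :: "'a pair_pre_digraph \<Rightarrow> 'a multiset \<Rightarrow> bool" where
  "cops_win G S \<longleftrightarrow>
     (\<exists>\<sigma>. cop_strategy G S \<sigma> \<and> (\<forall>R. robber_walk G R \<longrightarrow> (\<exists>n. captured_in_round \<sigma> R n)))"

definition cop_number :: "'a pair_pre_digraph \<Rightarrow> nat" where
  "cop_number G = (LEAST k. \<exists>S\<in>placements G k. cops_win G S)"

definition th_set :: "'a pair_pre_digraph \<Rightarrow> 'a multiset \<Rightarrow> enat" where
  "th_set G S = enat (size S) * (1 + capt G S)"

definition th_size :: "'a pair_pre_digraph \<Rightarrow> nat \<Rightarrow> enat" where
  "th_size G k = (INF S\<in>placements G k. th_set G S)"

text \<open>
  The case \<^term>\<open>k = 0\<close> has to be excluded because \<^term>\<open>0 * \<infinity> = (0::enat)\<close>.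
\<close>

definition th :: "'a pair_pre_digraph \<Rightarrow> enat" where
  "th G = (INF k\<in>{1..}. th_size G k)"

definition th_not_at_extremes :: "'a pair_pre_digraph \<Rightarrow> bool" where
  "th_not_at_extremes G \<longleftrightarrow>
     th_size G (domination_number G) > th G \<and> th_size G (cop_number G) > th G"

definition add_leaves :: "'a pair_pre_digraph \<Rightarrow> ('a \<times> bool) pair_pre_digraph" where
  "add_leaves G =
     \<lparr> pverts = pverts G \<times> UNIV,
       parcs = {((u, False), (v, False)) | u v. (u, v) \<in> parcs G}
             \<union> {((v, b), (v, \<not> b)) | v b. v \<in> pverts G} \<rparr>"

text \<open>
  \<^term>\<open>Cyc i\<close> for \<^term>\<open>i < 4\<close> are the vertices of the 4-cycle and \<^term>\<open>Pth i j\<close> for \<^term>\<open>j < l\<close> those of the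
  path paired with \<^term>\<open>Cyc i\<close>, where \<^term>\<open>i < 3\<close>. By symmetry of the cycle the choice of the
  three paired vertices is immaterial up to isomorphism.
\<close>

datatype vertex = Cyc nat | Pth nat nat

definition M' :: "nat \<Rightarrow> vertex pair_pre_digraph" where
  "M' l =
     (let E = {(Cyc i, Cyc ((i + 1) mod 4)) | i. i < 4}
            \<union> {(Pth i j, Pth i (j + 1)) | i j. i < 3 \<and> j + 1 < l}
            \<union> {(Cyc i, Pth i 0) | i. i < 3}
      in \<lparr> pverts = Cyc ` {..<4} \<union> {Pth i j | i j. i < 3 \<and> j < l}, parcs = E \<union> E\<inverse> \<rparr>)"

definition M :: "nat \<Rightarrow> (vertex \<times> bool) pair_pre_digraph" where
  "M l = add_leaves (M' l)"

lemma pverts_M'_eq: "pverts (M' l) = Cyc ` {..<4} \<union> (\<lambda>(i, j). Pth i j) ` ({..<3} \<times> {..<l})"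
  by (auto simp: M'_def Let_def)

lemma pair_graph_M':
  assumes "l \<ge> 1"
  shows "pair_graph (M' l)"
proof -
  have wf: "parcs (M' l) \<subseteq> pverts (M' l) \<times> pverts (M' l)"
    using assms by (auto simp: M'_def Let_def)
  have fin: "finite (pverts (M' l))"
    by (simp add: pverts_M'_eq)
  have sym: "(v, u) \<in> parcs (M' l)" if "(u, v) \<in> parcs (M' l)" for u v
    using that by (simp add: M'_def Let_def) blast
  have irr: "(u, u) \<notin> parcs (M' l)" for u
  proof -
    have "i \<noteq> Suc i mod 4" for i :: nat by presburger
    then have "Suc i mod 4 \<noteq> i" for i :: nat by metis
    then show ?thesis by (auto simp: M'_def Let_def)
  qed
  show ?thesis
    using wf fin sym irr finite_subset[OF wf]
    by unfold_locales (auto simp: symmetric_def sym_def)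
qed

lemma pair_graph_add_leaves:
  assumes "pair_graph G"
  shows "pair_graph (add_leaves G)"
proof -
  interpret pair_graph G by fact
  have wf: "parcs (add_leaves G) \<subseteq> pverts (add_leaves G) \<times> pverts (add_leaves G)"
    by (auto simp: add_leaves_def dest: wellformed')
  have fin: "finite (pverts (add_leaves G))"
    by (simp add: add_leaves_def)
  have sym: "(v, u) \<in> parcs (add_leaves G)" if "(u, v) \<in> parcs (add_leaves G)" for u v
    using that pair_sym_arcs by (auto simp: add_leaves_def symmetric_def dest: symD)
  have irr: "(u, u) \<notin> parcs (add_leaves G)" for u
    by (auto simp: add_leaves_def dest: pair_no_loops)
  show ?thesis
    using wf fin sym irr finite_subset[OF wf]
    by unfold_locales (auto simp: symmetric_def sym_def)
qed

lemma pair_graph_M: "l \<ge> 1 \<Longrightarrow> pair_graph (M l)"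
  unfolding M_def by (intro pair_graph_add_leaves pair_graph_M')

lemma card_pverts_M: "card (pverts (M l)) = 6 * l + 8"
proof -
  have "card (pverts (M' l)) = card (Cyc ` {..<4}) + card ((\<lambda>(i, j). Pth i j) ` ({..<3} \<times> {..<l}))"
    unfolding pverts_M'_eq by (intro card_Un_disjoint) auto
  also have "card (Cyc ` {..<4}) = 4"
    by (subst card_image) (auto simp: inj_on_def)
  also have "card ((\<lambda>(i, j). Pth i j) ` ({..<3} \<times> {..<l})) = 3 * l"
    by (subst card_image) (auto simp: inj_on_def card_cartesian_product)
  finally show ?thesis
    by (simp add: M_def add_leaves_def card_cartesian_product)
qed

end

theory Submission
  imports Defs
begin

text \<open>
  Three cops halfway up the three legs of \<open>M l\<close> catch the robber in about \<open>l / 2\<close> rounds: if he is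
  beyond one of them, that cop chases him to the end of the leg, otherwise all three walk inwards in
  step and confine him to the fourth cycle vertex. This gives a product of about \<open>3 l / 2\<close>.
  The cop number is \<open>2\<close>, since a robber evades a single cop on the 4-cycle, and two cops leave one leg
  together with its cycle vertex free, so a robber sitting on the leaf at the end of this leg survives
  until round \<open>l + 2\<close>, for a product of at least \<open>2 l + 6\<close>. Finally, a dominating set needs a vertex
  for each of the \<open>3 l + 4\<close> leaves, and with that many cops the product is at least \<open>6 l + 8\<close>, as
  capture in round \<open>0\<close> requires a cop on every vertex.
\<close>

subsection \<open>Capture times and evasion\<close>

lemma rel_mset_mem:
  assumes "rel_mset P A B" "y \<in># B"
  shows "\<exists>x\<in>#A. P x y"
  using assms by (induction rule: rel_mset_induct) auto

lemma rel_mset_step_refl: "rel_mset (step G) C C"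
  by (rule multiset.rel_refl) (simp add: step_def)

lemma rel_mset_step_add_mset:
  "step G x y \<Longrightarrow> rel_mset (step G) C D \<Longrightarrow> rel_mset (step G) (add_mset x C) (add_mset y D)"
  by (rule rel_mset_Plus)

lemma cops_at_0: "cop_strategy G S \<sigma> \<Longrightarrow> cops_at \<sigma> R 0 = S"
  by (simp add: cop_strategy_def cops_at_def)

text \<open>The robber stays on \<open>v\<close> for ever. Each move lowers \<open>\<phi>\<close> by
  at most one, so a cop needs at least \<open>n\<close> rounds to get from \<open>\<phi>\<close> at
  least \<open>n\<close> down to \<open>\<phi> v = 0\<close>.\<close>

lemma capt_ge_potential:
  fixes \<phi> :: "'a \<Rightarrow> nat"
  assumes v: "v \<in> pverts G" "\<phi> v = 0"
    and lip: "\<And>x y. step G x y \<Longrightarrow> \<phi> x \<le> Suc (\<phi> y)"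
    and far: "\<And>c. c \<in># S \<Longrightarrow> n \<le> \<phi> c"
  shows "enat n \<le> capt G S"
proof -
  define R where "R = (\<lambda>_::nat. v)"
  have walk: "robber_walk G R"
    using v by (simp add: robber_walk_def R_def step_def)
  have "enat n \<le> capture_round \<sigma> R" if str: "cop_strategy G S \<sigma>" for \<sigma>
  proof -
    have inv: "c \<in># cops_at \<sigma> R k \<Longrightarrow> n \<le> \<phi> c + k" for k c
    proof (induction k arbitrary: c)
      case 0
      then show ?case using cops_at_0[OF str] far by simp
    next
      case (Suc k)
      have "rel_mset (step G) (cops_at \<sigma> R k) (cops_at \<sigma> R (Suc k))"
        using str walk by (simp add: cop_strategy_def)
      then obtain x where "x \<in># cops_at \<sigma> R k" "step G x c"
        using rel_mset_mem Suc.prems by metis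
      then show ?case using Suc.IH[of x] lip[of x c] by simp
    qed
    \<comment> \<open>As the robber never moves, both forms of capture in round \<open>k\<close> put
      a cop on \<open>v\<close> at time \<open>k\<close>.\<close>
    have "n \<le> k" if "captured_in_round \<sigma> R k" for k
      using that inv[of v k] v by (auto simp: captured_in_round_def R_def)
    then show ?thesis
      by (auto simp: capture_round_def intro!: INF_greatest)
  qed
  then show ?thesis
    unfolding capt_def using walk
    by (auto intro!: INF_greatest intro: SUP_upper2)
qed

lemma capt_ge_1:
  assumes "size S < card (pverts G)"
  shows "1 \<le> capt G S"
proof -
  have "card (set_mset S) \<le> size S"
    by (metis size_multiset_overloaded_eq sum_mono card_eq_sum One_nat_def count_greater_zero_iff Suc_leI)
  then obtain v where v: "v \<in> pverts G" "v \<notin># S"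
    using assms by (metis card_mono finite_set_mset leD le_trans subsetI)
  have "enat 1 \<le> capt G S"
    by (rule capt_ge_potential[where v = v and \<phi> = "\<lambda>x. if x = v then 0 else 1"]) (use v in auto)
  then show ?thesis by (simp add: one_enat_def)
qed

text \<open>If some vertex is free of cops, capture takes a round and the product is at least
  \<open>2 * k\<close>; otherwise \<open>k\<close> alone is already large enough.\<close>

lemma card_le_th_size:
  assumes "card (pverts G) \<le> 2 * k"
  shows "enat (card (pverts G)) \<le> th_size G k"
  unfolding th_size_def
proof (rule INF_greatest)
  fix S assume "S \<in> placements G k"
  then have S: "size S = k" by (simp add: placements_def)
  show "enat (card (pverts G)) \<le> th_set G S"
  proof (cases "k < card (pverts G)")
    case True
    then have "1 \<le> capt G S" using S capt_ge_1 by auto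
    then have "enat k * (1 + 1) \<le> th_set G S"
      unfolding th_set_def S by (intro mult_left_mono add_left_mono) auto
    moreover have "enat k * (1 + 1) = enat (2 * k)"
      by (simp add: one_enat_def)
    ultimately show ?thesis using assms by (metis enat_ord_simps(1) order_trans)
  next
    case False
    have "enat k * (1 + 0) \<le> th_set G S"
      unfolding th_set_def S by (intro mult_left_mono add_left_mono) auto
    then show ?thesis using False by (metis add.right_neutral enat_ord_simps(1) mult.right_neutral not_less order_trans)
  qed
qed

section \<open>Sufficient conditions for the cops\<close>

text \<open>Cops on \<^term>\<open>C\<close>, robber on \<^term>\<open>r\<close>, the cops to move: they can force a capture within
  \<^term>\<open>n\<close> rounds. Quantifying over moves instead of strategies removes all bookkeeping about
  histories from the strategies for \<^term>\<open>M l\<close>.\<close>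

primrec catchable :: "'a pair_pre_digraph \<Rightarrow> nat \<Rightarrow> 'a multiset \<Rightarrow> 'a \<Rightarrow> bool" where
  "catchable G 0 C r \<longleftrightarrow> r \<in># C"
| "catchable G (Suc n) C r \<longleftrightarrow> r \<in># C \<or>
     (\<exists>C'. rel_mset (step G) C C' \<and> (r \<in># C' \<or> (\<forall>r'. step G r r' \<longrightarrow> catchable G n C' r')))"

declare catchable.simps(2) [simp del]

lemma catchable_mem: "r \<in># C \<Longrightarrow> catchable G n C r"
  by (cases n) (auto simp: catchable.simps(2))

lemma catchable_move:
  assumes "rel_mset (step G) C C'"
    and "\<And>r'. r \<notin># C' \<Longrightarrow> step G r r' \<Longrightarrow> catchable G n C' r'"
  shows "catchable G (Suc n) C r"
  using assms by (auto simp: catchable.simps(2))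

lemma catchable_Suc: "catchable G n C r \<Longrightarrow> catchable G (Suc n) C r"
proof (induction n arbitrary: C r)
  case 0
  then show ?case by (simp add: catchable_mem)
next
  case (Suc n)
  then show ?case unfolding catchable.simps(2)[of G n C r] by (metis catchable_mem catchable_move)
qed

lemma catchable_mono: "catchable G m C r \<Longrightarrow> m \<le> n \<Longrightarrow> catchable G n C r"
  by (rule lift_Suc_mono_le[of "\<lambda>n. catchable G n C r", unfolded le_bool_def, rule_format])
    (auto intro: catchable_Suc)

lemma catchable_adjacent:
  assumes "step G c r" "c \<in># C"
  shows "catchable G (Suc n) C r"
proof -
  obtain D where "C = add_mset c D" using assms(2) by (metis insert_DiffM)
  then show ?thesis
    using rel_mset_step_add_mset[OF assms(1) rel_mset_step_refl[of G D]]
    by (auto simp: catchable.simps(2))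
qed

text \<open>The strategy folds over the robber's history a pair of cop positions and rounds left,
  choosing a good reply each time. Until capture, the robber stays catchable within the rounds
  left.\<close>

lemma catchable_strategy:
  assumes init: "\<And>r. r \<in> pverts G \<Longrightarrow> catchable G T S r"
  obtains \<sigma> where "cop_strategy G S \<sigma>"
    and "\<And>R. robber_walk G R \<Longrightarrow> \<exists>n\<le>T. captured_in_round \<sigma> R n"
proof -
  define reply where "reply = (\<lambda>n C r C'. rel_mset (step G) C C' \<and>
    (r \<in># C' \<or> (\<forall>r'. step G r r' \<longrightarrow> catchable G (n - 1) C' r')))"
  \<comment> \<open>Without a good reply the cops stay put, which keeps the strategy legal against
    every walk, also after a capture.\<close>
  define f where "f = (\<lambda>(C, n) r.
    (if \<exists>C'. reply n C r C' then SOME C'. reply n C r C' else C, n - 1))"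
  define \<sigma> where "\<sigma> = (\<lambda>xs. fst (foldl f (S, T) xs))"
  have fst_f: "rel_mset (step G) (fst p) (fst (f p r))" for p r
    by (cases p) (auto simp: f_def reply_def rel_mset_step_refl intro: someI2)
  have str: "cop_strategy G S \<sigma>"
    using fst_f by (simp add: cop_strategy_def cops_at_def \<sigma>_def)
  have "\<exists>n\<le>T. captured_in_round \<sigma> R n" if walk: "robber_walk G R" for R
  proof -
    define s where "s = (\<lambda>n. foldl f (S, T) (map R [0..<n]))"
    have s_Suc: "s (Suc n) = f (s n) (R n)" for n
      by (simp add: s_def)
    have snd_s: "snd (s n) = T - n" for n
      by (induction n) (auto simp: s_Suc f_def split: prod.splits, simp add: s_def)
    have cops: "cops_at \<sigma> R n = fst (s n)" for n
      by (simp add: cops_at_def \<sigma>_def s_def)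
    have "(\<exists>m\<le>n. captured_in_round \<sigma> R m) \<or> catchable G (T - n) (fst (s n)) (R n)"
      if "n \<le> T" for n
      using that
    proof (induction n)
      case 0
      then show ?case using init walk by (auto simp: robber_walk_def s_def)
    next
      case (Suc n)
      obtain k where k: "T - n = Suc k" "T - Suc n = k" using Suc.prems
        by (metis Suc_diff_Suc Suc_le_lessD)
      show ?case
      proof (cases "\<exists>m\<le>n. captured_in_round \<sigma> R m")
        case True
        then show ?thesis using le_SucI by blast
      next
        case False
        then have c: "catchable G (Suc k) (fst (s n)) (R n)"
          using Suc.IH Suc.prems k by auto
        have "R n \<notin># fst (s n)"
          using False by (auto simp: captured_in_round_def cops)
        then have "\<exists>C'. reply (Suc k) (fst (s n)) (R n) C'"
          using c by (simp add: reply_def catchable.simps(2))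
        then have "reply (Suc k) (fst (s n)) (R n) (fst (s (Suc n)))"
          using snd_s[of n] k by (cases "s n") (auto simp: s_Suc f_def intro: someI)
        moreover have "step G (R n) (R (Suc n))"
          using walk by (simp add: robber_walk_def)
        moreover have "captured_in_round \<sigma> R (Suc n)" if "R n \<in># fst (s (Suc n))"
          using that by (auto simp: captured_in_round_def cops)
        ultimately show ?thesis
          using k by (auto simp: reply_def)
      qed
    qed
    \<comment> \<open>With no round left, \<open>catchable\<close> means that a cop stands on the
      robber.\<close>
    from this[of T] show ?thesis
      by (auto simp: captured_in_round_def cops)
  qed
  with str that show thesis by blast
qed

lemma capt_le_catchable:
  assumes "\<And>r. r \<in> pverts G \<Longrightarrow> catchable G T S r"
  shows "capt G S \<le> enat T"
proof -
  obtain \<sigma> where \<sigma>: "cop_strategy G S \<sigma>"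
    "\<And>R. robber_walk G R \<Longrightarrow> \<exists>n\<le>T. captured_in_round \<sigma> R n"
    using catchable_strategy[OF assms] by blast
  have "capture_round \<sigma> R \<le> enat T" if "robber_walk G R" for R
    using \<sigma>(2)[OF that] by (auto simp: capture_round_def intro: INF_lower2)
  then show ?thesis
    unfolding capt_def using \<sigma>(1) by (auto intro!: INF_lower2[of \<sigma>] SUP_least)
qed

lemma cops_win_catchable:
  assumes "\<And>r. r \<in> pverts G \<Longrightarrow> catchable G T S r"
  shows "cops_win G S"
  using catchable_strategy[OF assms] unfolding cops_win_def by metis

section \<open>A sufficient condition for the robber\<close>

text \<open>\<open>Safe\<close> is an invariant that the robber restores after each cop move:
  \<open>free\<close> excludes capture by his own move, \<open>evade\<close> capture by the cops'
  move.\<close>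

lemma not_cops_win_evasion:
  assumes init: "r0 \<in> pverts G" "Safe S r0"
    and free: "\<And>C r. Safe C r \<Longrightarrow> r \<notin># C"
    and evade: "\<And>C r C'. Safe C r \<Longrightarrow> rel_mset (step G) C C' \<Longrightarrow>
      r \<notin># C' \<and> (\<exists>r'. step G r r' \<and> Safe C' r')"
  shows "\<not> cops_win G S"
proof
  assume "cops_win G S"
  then obtain \<sigma> where str: "cop_strategy G S \<sigma>"
    and win: "\<And>R. robber_walk G R \<Longrightarrow> \<exists>n. captured_in_round \<sigma> R n"
    by (auto simp: cops_win_def)
  \<comment> \<open>The default \<open>r\<close> makes the walk legal before safety is known; the
    cops' moves, on which safety rests, are only known to be legal against legal walks.\<close>
  define g where "g = (\<lambda>C r. if \<exists>r'. step G r r' \<and> Safe C r' then SOME r'. step G r r' \<and> Safe C r' else r)"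
  \<comment> \<open>The cops' reply depends on the whole history, so the recursion builds histories
    and \<open>R\<close> reads off their last entries.\<close>
  define hist where "hist = rec_nat [r0] (\<lambda>_ h. h @ [g (\<sigma> h) (last h)])"
  define R where "R = (\<lambda>n. last (hist n))"
  have hist_Suc: "hist (Suc n) = hist n @ [g (\<sigma> (hist n)) (R n)]" for n
    by (simp add: hist_def R_def)
  have R_0: "R 0 = r0" by (simp add: R_def hist_def)
  have R_Suc': "R (Suc n) = g (\<sigma> (hist n)) (R n)" for n
    by (simp add: R_def hist_Suc)
  have hist: "map R [0..<Suc n] = hist n" for n
    by (induction n) (simp_all add: R_0 hist_Suc R_Suc', simp add: hist_def)
  have R_Suc: "R (Suc n) = g (cops_at \<sigma> R (Suc n)) (R n)" for n
    unfolding cops_at_def hist by (rule R_Suc')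
  have g_Safe: "step G r (g C r) \<and> Safe C (g C r)" if "\<exists>r'. step G r r' \<and> Safe C r'" for r C
    using someI_ex[OF that] that by (simp add: g_def)
  have g_step: "step G r (g C r)" for r C
  proof (cases "\<exists>r'. step G r r' \<and> Safe C r'")
    case True
    then show ?thesis using g_Safe by blast
  next
    case False
    then have "g C r = r" unfolding g_def by (rule if_not_P)
    then show ?thesis by (simp add: step_def)
  qed
  have walk: "robber_walk G R"
    using init(1) g_step by (simp add: robber_walk_def R_0 R_Suc)
  have mv: "rel_mset (step G) (cops_at \<sigma> R n) (cops_at \<sigma> R (Suc n))" for n
    using str walk by (simp add: cop_strategy_def)
  have safe: "Safe (cops_at \<sigma> R n) (R n)" for n
  proof (induction n)
    case 0
    then show ?case using init cops_at_0[OF str] R_0 by simp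
  next
    case (Suc n)
    then show ?case using evade[OF Suc mv] g_Safe R_Suc by metis
  qed
  obtain n where "captured_in_round \<sigma> R n" using win[OF walk] by blast
  then show False
    using free[OF safe] evade[OF safe mv] by (auto simp: captured_in_round_def)
qed

lemma card_verts_digraph_iso:
  assumes "digraph_iso G H"
  shows "card (verts G) = card (verts H)"
proof -
  obtain f where f: "pre_digraph.digraph_isomorphism G f" "H = app_iso f G"
    using assms by (auto simp: digraph_iso_def)
  then show ?thesis
    using card_image[OF pre_digraph.digraph_isomorphism_inj_on_verts[OF f(1)]] by simp
qed

subsection \<open>The graphs \<open>M l\<close>\<close>

text \<open>Each attached path is prolonged by its cycle vertex, so that leg \<open>i < 3\<close> has heights
  \<open>0, \<dots>, l\<close> with \<^term>\<open>Cyc i\<close> at height \<open>0\<close>; the fourth leg is \<^term>\<open>Cyc 3\<close> alone.\<close>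

fun leg_vertex :: "nat \<Rightarrow> nat \<Rightarrow> vertex" where
  "leg_vertex i 0 = Cyc i"
| "leg_vertex i (Suc k) = Pth i k"

lemma leg_vertex_eq_iff [simp]: "leg_vertex i m = leg_vertex i' m' \<longleftrightarrow> i = i' \<and> m = m'"
  by (cases m; cases m') auto

lemma leg_vertex_exhaust: obtains i m where "v = leg_vertex i m"
  by (metis leg_vertex.simps vertex.exhaust)

definition on_leg :: "nat \<Rightarrow> nat \<Rightarrow> nat \<Rightarrow> bool" where
  "on_leg l i m \<longleftrightarrow> i < 3 \<and> m \<le> l \<or> i = 3 \<and> m = 0"

lemma leg_vertex_in_M'_iff: "leg_vertex i m \<in> pverts (M' l) \<longleftrightarrow> on_leg l i m"
  by (cases m) (auto simp: M'_def Let_def on_leg_def)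

definition leg_adj :: "nat \<Rightarrow> nat \<Rightarrow> nat \<Rightarrow> nat \<Rightarrow> nat \<Rightarrow> bool" where
  "leg_adj l i m i' m' \<longleftrightarrow>
     i = i' \<and> i < 3 \<and> m \<le> l \<and> m' \<le> l \<and> (m' = Suc m \<or> m = Suc m') \<or>
     m = 0 \<and> m' = 0 \<and> i < 4 \<and> i' < 4 \<and> (i' = Suc i mod 4 \<or> i = Suc i' mod 4)"

lemma arc_M'_iff:
  assumes "1 \<le> l"
  shows "(leg_vertex i m, leg_vertex i' m') \<in> parcs (M' l) \<longleftrightarrow> leg_adj l i m i' m'"
  using assms by (cases m; cases m') (auto simp: M'_def Let_def leg_adj_def)

declare leg_vertex.simps [simp del]

lemma step_M_iff:
  assumes "1 \<le> l"
  shows "step (M l) (leg_vertex i m, b) (leg_vertex i' m', b') \<longleftrightarrow>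
     i = i' \<and> m = m' \<and> (b = b' \<or> on_leg l i m) \<or> \<not> b \<and> \<not> b' \<and> leg_adj l i m i' m'"
  using assms by (auto simp: step_def M_def add_leaves_def arc_M'_iff leg_vertex_in_M'_iff)

text \<open>The case \<open>stay\<close> includes the moves between a vertex and its leaf.\<close>

lemma step_M_cases:
  assumes "1 \<le> l" "step (M l) (leg_vertex i m, b) r"
  obtains (stay) b' where "r = (leg_vertex i m, b')"
  | (move) i' m' where "\<not> b" "r = (leg_vertex i' m', False)" "leg_adj l i m i' m'"
proof -
  obtain i' m' b' where "r = (leg_vertex i' m', b')"
    by (metis leg_vertex_exhaust surj_pair)
  then show thesis using assms that by (auto simp: step_M_iff)
qed

lemma vertex_M_cases:
  assumes "r \<in> pverts (M l)"
  obtains i m b where "r = (leg_vertex i m, b)" "on_leg l i m"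
proof -
  obtain i m b where "r = (leg_vertex i m, b)"
    by (metis leg_vertex_exhaust surj_pair)
  then show thesis using assms that by (auto simp: M_def add_leaves_def leg_vertex_in_M'_iff)
qed

section \<open>Chasing and confining the robber on the legs\<close>

text \<open>One cop walks outwards while \<open>D\<close> stays put. The robber cannot get past him:
  next to the cop he is caught, or he sits on a leaf from which he can only return to its
  base.\<close>

lemma catchable_outer:
  assumes l: "1 \<le> l" and i: "i < 3" and m: "m \<le> m'" "m' \<le> l"
  shows "catchable (M l) (Suc (l - m)) (add_mset (leg_vertex i m, False) D) (leg_vertex i m', b)"
  using m
proof (induction "l - m" arbitrary: m m' b)
  case 0
  then have "m = l" "m' = l" by auto
  then show ?case
    using l i by (intro catchable_adjacent[of _ "(leg_vertex i m, False)"])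
      (auto simp: step_M_iff on_leg_def)
next
  case (Suc d)
  show ?case
  proof (cases "m' = m")
    case True
    then show ?thesis
      using l i Suc.prems by (intro catchable_adjacent[of _ "(leg_vertex i m, False)"])
        (auto simp: step_M_iff on_leg_def)
  next
    case False
    let ?C = "add_mset (leg_vertex i (Suc m), False) D"
    have IH: "catchable (M l) (l - m) ?C (leg_vertex i k, b')" if "Suc m \<le> k" "k \<le> l" for k b'
      using Suc.hyps(1)[of "Suc m" k b'] Suc.hyps(2) that by (simp add: Suc_diff_Suc)
    show ?thesis
    proof (rule catchable_move)
      show "rel_mset (step (M l)) (add_mset (leg_vertex i m, False) D) ?C"
        using l i Suc.prems False
        by (intro rel_mset_step_add_mset rel_mset_step_refl) (auto simp: step_M_iff leg_adj_def)
      fix r' assume fresh: "(leg_vertex i m', b) \<notin># ?C"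
        and "step (M l) (leg_vertex i m', b) r'"
      from l this(2) show "catchable (M l) (l - m) ?C r'"
      proof (cases rule: step_M_cases)
        case stay
        then show ?thesis using IH Suc.prems False by simp
      next
        case (move i' k)
        then have "m' \<noteq> Suc m" using fresh by auto
        then have "i' = i \<and> Suc m \<le> k \<and> k \<le> l"
          using move Suc.prems False by (auto simp: leg_adj_def)
        then show ?thesis using IH move by simp
      qed
    qed
  qed
qed

definition cops3 :: "nat \<Rightarrow> (vertex \<times> bool) multiset" where
  "cops3 k = {#(leg_vertex 0 k, False), (leg_vertex 1 k, False), (leg_vertex 2 k, False)#}"

lemma cops3_mem: "i < 3 \<Longrightarrow> (leg_vertex i k, False) \<in># cops3 k"
  by (auto simp: cops3_def less_Suc_eq numeral_3_eq_3 numeral_2_eq_2)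

text \<open>The three cops descend together; a robber below them remains below, runs into a cop, or
  is left on a leaf beside one. This takes \<open>k\<close> rounds down to the cycle and two more
  for its fourth vertex.\<close>

lemma catchable_inner:
  assumes l: "1 \<le> l" and "k \<le> l" "i < 3 \<and> m < k \<or> i = 3 \<and> m = 0"
  shows "catchable (M l) (k + 2) (cops3 k) (leg_vertex i m, b)"
  using assms(2,3)
proof (induction k arbitrary: i m b)
  case 0
  \<comment> \<open>The robber is confined to \<open>Cyc 3\<close> and its leaf; the cop from
    \<open>Cyc 0\<close> steps onto \<open>Cyc 3\<close>.\<close>
  let ?C = "add_mset (leg_vertex 3 0, False) {#(leg_vertex 1 0, False), (leg_vertex 2 0, False)#}"
  have "rel_mset (step (M l)) (cops3 0) ?C"
    unfolding cops3_def
    using l by (intro rel_mset_step_add_mset rel_mset_step_refl) (auto simp: step_M_iff leg_adj_def)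
  moreover have "catchable (M l) 1 ?C r'"
    if "(leg_vertex i m, b) \<notin># ?C" "step (M l) (leg_vertex i m, b) r'" for r'
    unfolding One_nat_def
  proof (rule catchable_adjacent)
    show "step (M l) (leg_vertex 3 0, False) r'"
      using l that(2) that(1) 0
      by (cases rule: step_M_cases) (auto simp: step_M_iff[OF l] on_leg_def)
  qed simp
  ultimately have "catchable (M l) (Suc 1) (cops3 0) (leg_vertex i m, b)"
    by (rule catchable_move)
  then show ?case by (simp only: add_0 one_add_one[symmetric] plus_1_eq_Suc)
next
  case (Suc k)
  have "rel_mset (step (M l)) (cops3 (Suc k)) (cops3 k)"
    unfolding cops3_def
    using l Suc.prems by (intro rel_mset_step_add_mset rel_mset_step_refl) (auto simp: step_M_iff leg_adj_def)
  moreover have "catchable (M l) (k + 2) (cops3 k) r'"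
    if fresh: "(leg_vertex i m, b) \<notin># cops3 k" and st: "step (M l) (leg_vertex i m, b) r'" for r'
  proof (cases "i < 3 \<and> m = k")
    case True
    \<comment> \<open>At height \<open>k\<close> but not caught, the robber must be on the leaf of a
      cop's vertex.\<close>
    then have b using fresh cops3_mem by (metis (full_types))
    have "catchable (M l) (Suc (k + 1)) (cops3 k) r'"
    proof (rule catchable_adjacent[OF _ cops3_mem])
      show "step (M l) (leg_vertex i k, False) r'"
        using l st True \<open>b\<close> Suc.prems
        by (cases rule: step_M_cases) (auto simp: step_M_iff[OF l] on_leg_def)
    qed (use True in simp)
    then show ?thesis by simp
  next
    case False
    then have inner: "i < 3 \<and> m < k \<or> i = 3 \<and> m = 0" using Suc.prems by auto
    from l st show ?thesis
    proof (cases rule: step_M_cases)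
      case stay
      then show ?thesis using Suc.IH Suc.prems inner by simp
    next
      case (move i' m')
      then have "i' < 3 \<and> m' < k \<or> i' = 3 \<and> m' = 0 \<or> i' < 3 \<and> m' = k"
        using inner by (auto simp: leg_adj_def)
      then show ?thesis
        using Suc.IH[of i' m' False] Suc.prems(1) move(2) cops3_mem[of i' k]
          catchable_mem[of r' "cops3 k"] by auto
    qed
  qed
  ultimately have "catchable (M l) (Suc (k + 2)) (cops3 (Suc k)) (leg_vertex i m, b)"
    by (rule catchable_move)
  then show ?case by simp
qed

lemma capt_cops3:
  assumes "1 \<le> l" "k \<le> l"
  shows "capt (M l) (cops3 k) \<le> enat (max (k + 2) (Suc (l - k)))"
proof (rule capt_le_catchable)
  fix r assume "r \<in> pverts (M l)"
  then obtain i m b where r: "r = (leg_vertex i m, b)" and "on_leg l i m"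
    by (rule vertex_M_cases)
  then consider "i < 3 \<and> m < k \<or> i = 3 \<and> m = 0" | "i < 3" "k \<le> m" "m \<le> l"
    unfolding on_leg_def by linarith
  then show "catchable (M l) (max (k + 2) (Suc (l - k))) (cops3 k) r"
  proof cases
    case 1
    then show ?thesis unfolding r by (intro catchable_mono[OF catchable_inner]) (use assms in auto)
  next
    case 2
    obtain D where "cops3 k = add_mset (leg_vertex i k, False) D"
      using cops3_mem[OF 2(1)] by (metis insert_DiffM)
    then show ?thesis unfolding r using catchable_mono[OF catchable_outer[OF assms(1) 2]] by simp
  qed
qed

section \<open>The cop number\<close>

text \<open>The cops start on opposite cycle vertices. A robber on leg 0 or 2 is chased outwards at
  once; for leg 1 or 3 the cop from \<open>Cyc 0\<close> first steps onto its cycle vertex and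
  thereby closes it off.\<close>

lemma two_cops_win_M:
  assumes l: "1 \<le> l"
  shows "cops_win (M l) {#(leg_vertex 0 0, False), (leg_vertex 2 0, False)#}"
    (is "cops_win _ ?S")
proof (rule cops_win_catchable)
  fix r assume "r \<in> pverts (M l)"
  then obtain i m b where r: "r = (leg_vertex i m, b)" and on: "on_leg l i m"
    by (rule vertex_M_cases)
  have chase: "catchable (M l) (Suc (Suc l)) ?S r"
    if "i = 1 \<or> i = 3"
  proof (rule catchable_move)
    let ?C = "add_mset (leg_vertex i 0, False) {#(leg_vertex 2 0, False)#}"
    show "rel_mset (step (M l)) ?S ?C"
      using l that
      by (intro rel_mset_step_add_mset rel_mset_step_refl) (auto simp: step_M_iff leg_adj_def)
    fix r' assume fresh: "r \<notin># ?C" and "step (M l) r r'"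
    from l this(2) obtain m' b' where r': "r' = (leg_vertex i m', b')" and on': "on_leg l i m'"
      unfolding r using fresh on
      by (cases rule: step_M_cases) (auto simp: r leg_adj_def on_leg_def)
    show "catchable (M l) (Suc l) ?C r'"
    proof (cases "i = 3")
      case True
      then show ?thesis using l on' unfolding r'
        by (intro catchable_adjacent[of _ "(leg_vertex i 0, False)"]) (auto simp: step_M_iff on_leg_def)
    next
      case False
      then show ?thesis using catchable_outer[OF l, of i 0 m'] that on' unfolding r'
        by (simp add: on_leg_def)
    qed
  qed
  consider "i = 0" | "i = 2" | "i = 1 \<or> i = 3" using on by (force simp: on_leg_def)
  then show "catchable (M l) (Suc (Suc l)) ?S r"
  proof cases
    case 1
    then show ?thesis
      using catchable_Suc[OF catchable_outer[OF l, of 0 0 m]] on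
      by (simp add: r on_leg_def)
  next
    case 2
    then show ?thesis
      using catchable_Suc[OF catchable_outer[OF l, of 2 0 m "{#(leg_vertex 0 0, False)#}"]] on
      by (simp add: r on_leg_def add_mset_commute)
  qed (rule chase)
qed

text \<open>The robber keeps to the 4-cycle, always ending his move on a vertex that the cop cannot
  enter next.\<close>

lemma one_cop_loses_M:
  assumes l: "1 \<le> l"
  shows "\<not> cops_win (M l) {#s#}"
proof -
  define Safe where "Safe = (\<lambda>C r. \<exists>c i. C = {#c#} \<and> i < 4 \<and>
    r = (leg_vertex i 0, False) \<and> \<not> step (M l) c r)"
  have escape: "\<exists>j<4. step (M l) (leg_vertex i 0, False) (leg_vertex j 0, False) \<and>
      \<not> step (M l) c (leg_vertex j 0, False)"
    if "i < 4" "c \<noteq> (leg_vertex i 0, False)" for i c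
  proof -
    obtain k m b where c: "c = (leg_vertex k m, b)"
      by (metis leg_vertex_exhaust surj_pair)
    have stepj: "step (M l) (leg_vertex i 0, False) (leg_vertex j 0, False) \<longleftrightarrow>
        i = j \<or> j = Suc i mod 4 \<or> i = Suc j mod 4" if "j < 4" for j
      using l that \<open>i < 4\<close> by (auto simp: step_M_iff leg_adj_def)
    show ?thesis
    proof (cases "k = i")
      case True
      \<comment> \<open>The cop is on the robber's leg but not on \<open>Cyc i\<close>, so
        \<open>Cyc i\<close> is the only cycle vertex he can enter.\<close>
      then have "\<not> step (M l) c (leg_vertex (Suc i mod 4) 0, False)"
        using l that unfolding c by (auto simp: step_M_iff leg_adj_def) presburger+
      then show ?thesis using stepj[of "Suc i mod 4"] by (intro exI[of _ "Suc i mod 4"]) simp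
    next
      case False
      \<comment> \<open>the cycle vertex opposite to the cop's leg, in reach because \<open>i \<noteq> k\<close>\<close>
      let ?j = "(k + 2) mod 4"
      show ?thesis
      proof (cases "k < 4")
        case True
        then have "\<not> step (M l) c (leg_vertex ?j 0, False)"
          using l unfolding c by (auto simp: step_M_iff leg_adj_def) presburger+
        moreover have "i = ?j \<or> ?j = Suc i mod 4 \<or> i = Suc ?j mod 4"
        proof -
          have "k \<in> {0, 1, 2, 3}" "i \<in> {0, 1, 2, 3}" using True \<open>i < 4\<close> by auto
          then show ?thesis using \<open>k \<noteq> i\<close> by auto
        qed
        ultimately show ?thesis using stepj[of ?j] by (intro exI[of _ ?j]) simp
      next
        case False
        then show ?thesis using l \<open>i < 4\<close> unfolding c
          by (intro exI[of _ i]) (auto simp: step_M_iff leg_adj_def)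
      qed
    qed
  qed
  obtain i0 where i0: "i0 < 4" "\<not> step (M l) s (leg_vertex i0 0, False)"
  proof (cases "s = (leg_vertex 0 0, False)")
    case True
    then show thesis using that[of 2] l by (simp add: step_M_iff leg_adj_def)
  next
    case False
    then show thesis using escape[of 0 s] that by auto
  qed
  show ?thesis
  proof (rule not_cops_win_evasion)
    show "(leg_vertex i0 0, False) \<in> pverts (M l)"
      using i0 by (simp add: M_def add_leaves_def leg_vertex_in_M'_iff on_leg_def) auto
    show "Safe {#s#} (leg_vertex i0 0, False)"
      using i0 unfolding Safe_def by blast
    show "r \<notin># C" if "Safe C r" for C r
      using that by (auto simp: Safe_def step_def)
    show "r \<notin># C' \<and> (\<exists>r'. step (M l) r r' \<and> Safe C' r')"
      if safe: "Safe C r" and mv: "rel_mset (step (M l)) C C'" for C r C'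
    proof -
      obtain c i where c: "C = {#c#}" "i < 4" "r = (leg_vertex i 0, False)" "\<not> step (M l) c r"
        using safe by (auto simp: Safe_def)
      obtain c' where c': "C' = {#c'#}" "step (M l) c c'"
        using msed_rel_invL[of "step (M l)" c "{#}" C'] mv c(1) by (auto simp del: split_paired_Ex)
      then have "c' \<noteq> r" using c by auto
      then obtain j where "j < 4" "step (M l) r (leg_vertex j 0, False)"
        "\<not> step (M l) c' (leg_vertex j 0, False)"
        using escape[of i c'] c by auto
      then have "Safe C' (leg_vertex j 0, False)" using c'(1) unfolding Safe_def by blast
      with \<open>step (M l) r (leg_vertex j 0, False)\<close> show ?thesis
        using \<open>c' \<noteq> r\<close> c'(1) by auto
    qed
  qed
qed

lemma cop_number_M:
  assumes l: "1 \<le> l"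
  shows "cop_number (M l) = 2"
  unfolding cop_number_def
proof (rule Least_equality)
  have "{#(leg_vertex 0 0, False), (leg_vertex 2 0, False)#} \<in> placements (M l) 2"
    by (auto simp: placements_def M_def add_leaves_def leg_vertex_in_M'_iff on_leg_def)
  then show "\<exists>S\<in>placements (M l) 2. cops_win (M l) S"
    using two_cops_win_M[OF l] by blast
  fix k assume "\<exists>S\<in>placements (M l) k. cops_win (M l) S"
  then obtain S where S: "set_mset S \<subseteq> pverts (M l)" "size S = k" and win: "cops_win (M l) S"
    by (auto simp: placements_def)
  have "(leg_vertex 0 0, False) \<in> pverts (M l)"
    by (simp add: M_def add_leaves_def leg_vertex_in_M'_iff on_leg_def)
  \<comment> \<open>No cops remain no cops, so every robber position is safe.\<close>
  then have "\<not> cops_win (M l) {#}"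
    by (rule not_cops_win_evasion[where Safe = "\<lambda>C r. C = {#}"]) (auto simp: step_def)
  then have "k \<noteq> 0" using S win by (metis size_eq_0_iff_empty)
  moreover have "k \<noteq> 1"
  proof
    assume "k = 1"
    then obtain s where "S = {#s#}" using S(2) size_1_singleton_mset by metis
    then show False using one_cop_loses_M[OF l, of s] S win by simp
  qed
  ultimately show "2 \<le> k" by simp
qed

section \<open>Lower bounds for two cops and for dominating sets\<close>

lemma capt_two_cops_M:
  assumes l: "1 \<le> l" and S: "size S = 2"
  shows "enat (l + 2) \<le> capt (M l) S"
proof -
  obtain x N where N: "S = add_mset x N"
    using S size_eq_Suc_imp_eq_union[of S 1] by auto
  then have "size N = 1" using S by simp
  then obtain y where xy: "S = {#x, y#}"
    using N size_1_singleton_mset by metis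
  define leg where "leg = (\<lambda>v. case v of Cyc i \<Rightarrow> i | Pth i j \<Rightarrow> i)"
  define ht where "ht = (\<lambda>v. case v of Cyc i \<Rightarrow> 0 | Pth i j \<Rightarrow> Suc j)"
  have leg: "leg (leg_vertex i m) = i" for i m
    by (cases m) (simp_all add: leg_def leg_vertex.simps)
  have ht: "ht (leg_vertex i m) = m" for i m
    by (cases m) (simp_all add: ht_def leg_vertex.simps)
  have "\<exists>i<3. i \<noteq> a \<and> i \<noteq> b" for a b :: nat
    by presburger
  then obtain i where i: "i < 3" "i \<noteq> leg (fst x)" "i \<noteq> leg (fst y)" by blast
  \<comment> \<open>a lower bound for the distance to the leaf at the far end of the cop-free leg \<open>i\<close>\<close>
  define \<phi> where "\<phi> = (\<lambda>(v, b). if leg v = i then l + 1 - ht v - (if b then 1 else 0) else l + 2)"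
  show ?thesis
  proof (rule capt_ge_potential[where \<phi> = \<phi>])
    show "(leg_vertex i l, True) \<in> pverts (M l)"
      using i by (simp add: M_def add_leaves_def leg_vertex_in_M'_iff on_leg_def)
    show "\<phi> (leg_vertex i l, True) = 0"
      by (simp add: \<phi>_def leg ht)
    show "l + 2 \<le> \<phi> c" if "c \<in># S" for c
      using that i by (auto simp: xy \<phi>_def split: prod.split)
    fix p q assume "step (M l) p q"
    moreover obtain j m b where "p = (leg_vertex j m, b)"
      by (metis leg_vertex_exhaust surj_pair)
    moreover obtain j' m' b' where "q = (leg_vertex j' m', b')"
      by (metis leg_vertex_exhaust surj_pair)
    \<comment> \<open>Leg \<open>i\<close> is entered only through \<open>Cyc i\<close>, where
      \<open>\<phi>\<close> is \<open>l + 1\<close>, against \<open>l + 2\<close> elsewhere.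
      Counting each leaf as one closer than its base is exact only at the far end, but keeps
      \<open>\<phi>\<close> a lower bound.\<close>
    ultimately show "\<phi> p \<le> Suc (\<phi> q)"
      using l by (auto simp: step_M_iff \<phi>_def leg ht leg_adj_def)
  qed
qed

text \<open>The leaf of \<open>v\<close> is dominated only by itself or by \<open>v\<close>, so
  \<open>D\<close> projects onto all of \<open>M' l\<close>, half the size of
  \<open>M l\<close>.\<close>

lemma card_dominating_set_M:
  assumes l: "1 \<le> l" and D: "dominating_set (M l) D"
  shows "3 * l + 4 \<le> card D"
proof -
  have fin: "finite (pverts (M l))"
    by (rule card_ge_0_finite) (simp add: card_pverts_M)
  have "D \<subseteq> pverts (M l)" using D by (simp add: dominating_set_def)
  then have finD: "finite D" using fin finite_subset by blast
  have "pverts (M' l) \<subseteq> fst ` D"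
  proof
    fix v assume "v \<in> pverts (M' l)"
    then have "(v, True) \<in> pverts (M l)" by (simp add: M_def add_leaves_def)
    then show "v \<in> fst ` D"
      using D by (force simp: dominating_set_def M_def add_leaves_def)
  qed
  then have "card (pverts (M' l)) \<le> card D"
    using finD by (metis card_image_le card_mono finite_imageI le_trans)
  moreover have "card (pverts (M l)) = card (pverts (M' l)) * 2"
    by (simp add: M_def add_leaves_def card_cartesian_product)
  ultimately show ?thesis using card_pverts_M[of l] by simp
qed

lemma domination_number_M_ge:
  assumes "1 \<le> l"
  shows "3 * l + 4 \<le> domination_number (M l)"
proof -
  \<comment> \<open>Some dominating set must be exhibited for the \<open>LEAST\<close> to be
    attained.\<close>
  have "dominating_set (M l) (pverts (M l))" by (simp add: dominating_set_def)
  then have "\<exists>k D. dominating_set (M l) D \<and> card D = k" by blast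
  then have "\<exists>D. dominating_set (M l) D \<and> card D = domination_number (M l)"
    unfolding domination_number_def by (rule LeastI_ex)
  then show ?thesis using card_dominating_set_M[OF assms] by metis
qed

section \<open>Comparing the products\<close>

lemma th_M_le:
  assumes "1 \<le> l" "k \<le> l"
  shows "th (M l) \<le> enat (3 * (1 + max (k + 2) (Suc (l - k))))"
proof -
  have S: "cops3 k \<in> placements (M l) 3"
    using assms by (auto simp: placements_def cops3_def M_def add_leaves_def leg_vertex_in_M'_iff on_leg_def)
  have "th (M l) \<le> th_size (M l) 3"
    unfolding th_def by (rule INF_lower) simp
  also have "\<dots> \<le> th_set (M l) (cops3 k)"
    unfolding th_size_def by (rule INF_lower[OF S])
  also have "\<dots> \<le> enat 3 * (1 + enat (max (k + 2) (Suc (l - k))))"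
    unfolding th_set_def using S capt_cops3[OF assms]
    by (intro mult_mono add_left_mono) (auto simp: placements_def)
  finally show ?thesis by (simp add: one_enat_def)
qed

lemma th_size_2_M:
  assumes "1 \<le> l"
  shows "enat (2 * (l + 3)) \<le> th_size (M l) 2"
  unfolding th_size_def
proof (rule INF_greatest)
  fix S assume "S \<in> placements (M l) 2"
  then have S: "size S = 2" by (simp add: placements_def)
  have "enat 2 * (1 + enat (l + 2)) \<le> th_set (M l) S"
    unfolding th_set_def S using capt_two_cops_M[OF assms S]
    by (intro mult_left_mono add_left_mono) auto
  moreover have "enat 2 * (1 + enat (l + 2)) = enat (2 * (l + 3))"
    by (simp add: one_enat_def)
  ultimately show "enat (2 * (l + 3)) \<le> th_set (M l) S" by simp
qed

lemma th_not_at_extremes_M: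
  assumes "7 \<le> l"
  shows "th_not_at_extremes (M l)"
proof -
  \<comment> \<open>the height balancing the capture times \<open>k + 2\<close> inside and \<open>l - k + 1\<close> outside\<close>
  define k where "k = (l - 1) div 2"
  have l: "1 \<le> l" "k \<le> l" using assms by (auto simp: k_def)
  have bound: "3 * (1 + max (k + 2) (Suc (l - k))) < 2 * (l + 3)"
  proof -
    have "2 * k + 1 \<le> l" "l \<le> 2 * k + 2" using assms unfolding k_def by linarith+
    \<comment> \<open>Since \<open>k\<close> is at least \<open>(l - 2) / 2\<close>, the second
      inequality reduces to \<open>3 * l + 6 < 4 * l\<close>, which is where
      \<open>7 \<le> l\<close> enters.\<close>
    then have "3 * k + 9 < 2 * l + 6" "3 * (l - k) + 6 < 2 * l + 6" using assms by linarith+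
    then show ?thesis by (simp add: max_def)
  qed
  \<comment> \<open>The value \<open>2 * (l + 3)\<close> separates \<open>th (M l)\<close> from both
    extremes.\<close>
  have "th (M l) < enat (2 * (l + 3))"
    using th_M_le[OF l] bound by (metis enat_ord_simps(2) le_less_trans)
  moreover have "enat (2 * (l + 3)) \<le> th_size (M l) 2"
    by (rule th_size_2_M[OF l(1)])
  moreover have "enat (2 * (l + 3)) \<le> th_size (M l) (domination_number (M l))"
  proof -
    have "enat (card (pverts (M l))) \<le> th_size (M l) (domination_number (M l))"
      using domination_number_M_ge[OF l(1)] by (intro card_le_th_size) (simp add: card_pverts_M)
    moreover have "enat (2 * (l + 3)) \<le> enat (card (pverts (M l)))"
      by (simp add: card_pverts_M)
    ultimately show ?thesis by (rule order_trans[rotated])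
  qed
  ultimately show ?thesis
    unfolding th_not_at_extremes_def cop_number_M[OF l(1)] by (meson less_le_trans)
qed

theorem theorem4p7:
  shows "(\<exists>\<G> :: (vertex \<times> bool) pair_pre_digraph set.
            infinite \<G> \<and>
            (\<forall>G\<in>\<G>. \<forall>H\<in>\<G>. G \<noteq> H \<longrightarrow> \<not> digraph_iso (with_proj G) (with_proj H)) \<and>
            (\<forall>G\<in>\<G>. pair_graph G \<and> pverts G \<noteq> {} \<and> th_not_at_extremes G)) \<and>
         (\<forall>l\<ge>7. th_not_at_extremes (M l))"
proof (intro conjI exI[of _ "M ` {7..}"])
  \<comment> \<open>The vertex count \<open>6 * l + 8\<close> gives both injectivity and pairwise
    non-isomorphism.\<close>
  have "inj M"
    by (rule injI) (metis card_pverts_M add_right_cancel mult_cancel1 zero_neq_numeral)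
  then show "infinite (M ` {7..})"
    by (meson finite_imageD infinite_Ici inj_on_subset subset_UNIV)
  show "\<forall>G\<in>M ` {7..}. \<forall>H\<in>M ` {7..}. G \<noteq> H \<longrightarrow> \<not> digraph_iso (with_proj G) (with_proj H)"
    by (auto dest!: card_verts_digraph_iso simp: card_pverts_M)
  show "\<forall>G\<in>M ` {7..}. pair_graph G \<and> pverts G \<noteq> {} \<and> th_not_at_extremes G"
  proof (rule ballI, elim imageE, intro conjI)
    fix G l assume G: "G = M l" "l \<in> {7..}"
    then show "pair_graph G" "th_not_at_extremes G"
      by (auto intro: pair_graph_M th_not_at_extremes_M)
    show "pverts G \<noteq> {}" using card_pverts_M[of l] G by auto
  qed
  show "\<forall>l\<ge>7. th_not_at_extremes (M l)" using th_not_at_extremes_M by blast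
qed

end
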